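(* Let $n\ge 1$, $p=n(n+1)/2$, let $\mathcal S\subset\mathbb Z_+^n$ be a finite nonempty set of configurations with a fixed tie-breaking order, and let $D=\max_{(u,v)\in\mathcal S^2}\|u-v\|_\infty$. Consider an expert projective cone scheduler with parameter array $b$, and let $(y_1,s_1),\dots,(y_T,s_T)$ be the observed normalized backlogs and expert decisions, $s_t=\mu(y_t;b)$. Run the fixed-horizon multiplicative-weights algorithm (Algorithm 1 in the context) on these observations, and let $\ell_t$ be the resulting losses. If $T$ is a positive integer with $T>4\ln(p)$, then $$0\le \frac1T\sum_{t=1}^T \ell_t\le 2D\sqrt{\frac{\ln(p)}{T}}.$$
   Context: Notation: $\mathbb Z_+=\{0,1,2,\dots\}$, $[n]=\{1,\dots,n\}$. "Array" means a real array indexed by pairs $(i,j)\in[n]^2$ with $i\le j$ (so it has $p=n(n+1)/2$ entries). $\sigma(i,j)=1$ if $i=j$ and $-1$ if $i\ne j$. For $u,y\in\mathbb R^n$ and $i\le j$ put $q_{ij}(u,y)=u(i)y(i)$ if $i=j$ and $q_{ij}(u,y)=u(i)y(j)+u(j)y(i)$ if $i<j$. Queueing model: backlogs $x_t\in\mathbb Z_+^n$ satisfy $x_{t+1}=x_t-d_t+a_t$ with $x_0\in\mathbb Z_+^n$ arbitrary, $d_t=\min\{s_t,x_t\}$ componentwise, where $s_t\in\mathcal S$ is the expert's configuration, and arrivals $a_t\in\mathbb Z_+^n$ that are arbitrary (they may depend arbitrarily on past backlogs, arrivals and configurations). The normalized backlog is $y_t=x_t/\|x_t\|_1$ if $\|x_t\|_1\neq0$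 and $y_t=0$ otherwise. Scheduler: for an array $\beta$ and $y\in\mathbb R_+^n$, $$\mu(y;\beta)=\arg\max_{s\in\mathcal S}\sum_{i\le j}\sigma(i,j)\,\beta(i,j)\,q_{ij}(s,y),$$ with ties broken by the fixed ordering of $\mathcal S$. The expert is given by a symmetric positive-definite $B\in\mathbb R^{n\times n}$ with non-positive off-diagonal entries, and chooses $s_t=\arg\max_{s\in\mathcal S}\langle s,Bx_t\rangle$ (same tie-breaking). Its array $b$ is $b(i,i)=cB(i,i)$ and $b(i,j)=-cB(i,j)$ for $i<j$, with $c>0$ chosen so that $\sum_{i\le j}b(i,j)=1$; thus $b\ge0$ and $s_t=\mu(x_t;b)=\mu(y_t;b)$. Algorithm 1 (horizon $T$): set $\eta=\sqrt{\ln(p)/T}$ and $w_1(i,j)=1$ for all $i\le j$. For $t=1,\dots,T$: set $\hat b_t=w_t/\sum_{i\le j}w_t(i,j)$, $\hat s_t=\mu(y_t;\hat b_t)$, $\delta_t=\hat s_t-s_t$. If $\delta_t=0$ let $m_t=0$; otherwise let $z_t=\delta_t/\|\delta_t\|_\infty$ and $m_t(i,j)=\sigma(i,j)\,q_{ij}(z_t,y_t)$ for $i\le j$. Update $w_{t+1}(i,j)=w_t(i,j)(1-\eta\, m_t(i,j))$. Loss: $\ell_t=\sum_{i\le j}\sigma(i,j)\,(\hat b_t(i,j)-b(i,j))\,q_{ij}(\delta_t,y_t)$. *)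

theory Defs
  imports "HOL-Analysis.Analysis"
begin

text \<open>
  The index set \<open>[n]\<close> is rendered by a finite linearly ordered type \<open>'n\<close>, with \<open>n = CARD('n)\<close>;
  the order is only used to single out the pairs \<open>i \<le> j\<close>.  An array is a function
  \<open>'n \<Rightarrow> 'n \<Rightarrow> real\<close> of which only the values at pairs \<open>i \<le> j\<close> are ever used.
\<close>

definition upairs :: "('n::{finite,linorder} \<times> 'n) set" where
  "upairs = {(i, j). i \<le> j}"

definition sgn_pair :: "'n \<Rightarrow> 'n \<Rightarrow> real" where
  "sgn_pair i j = (if i = j then 1 else -1)"

definition qform :: "'n::finite \<Rightarrow> 'n \<Rightarrow> real^'n \<Rightarrow> real^'n \<Rightarrow> real" where
  "qform i j u y = (if i = j then u $ i * y $ i else u $ i * y $ j + u $ j * y $ i)"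

definition pairing ::
  "('n \<Rightarrow> 'n \<Rightarrow> real) \<Rightarrow> real^'n::{finite,linorder} \<Rightarrow> real^'n::_ \<Rightarrow> real" where
  "pairing \<beta> u y = (\<Sum>(i, j)\<in>upairs. sgn_pair i j * \<beta> i j * qform i j u y)"

definition real_vec :: "nat^'n \<Rightarrow> real^'n::finite" where
  "real_vec x = (\<chi> i. real (x $ i))"

definition l1_norm :: "real^'n::finite \<Rightarrow> real" where
  "l1_norm x = (\<Sum>i\<in>UNIV. \<bar>x $ i\<bar>)"

definition normalized_backlog :: "nat^'n \<Rightarrow> real^'n::finite" where
  "normalized_backlog x =
     (if l1_norm (real_vec x) \<noteq> 0 then (1 / l1_norm (real_vec x)) *\<^sub>R real_vec x else 0)"

text \<open>
  The maximizer of \<open>f\<close> over \<open>S\<close> that comes first in the order \<open>r\<close>; it exists and is unique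
  when \<open>S\<close> is finite and nonempty and \<open>r\<close> is a linear order on \<open>S\<close>.
\<close>

definition argmax_first :: "'a set \<Rightarrow> ('a \<times> 'a) set \<Rightarrow> ('a \<Rightarrow> real) \<Rightarrow> 'a" where
  "argmax_first S r f =
     (THE s. s \<in> S \<and> (\<forall>s'\<in>S. f s' \<le> f s) \<and> (\<forall>s'\<in>S. f s' = f s \<longrightarrow> (s, s') \<in> r))"

definition mu :: "(nat^'n::{finite,linorder}) set \<Rightarrow> ((nat^'n::_) \<times> (nat^'n::_)) set \<Rightarrow> real^'n::_
    \<Rightarrow> ('n \<Rightarrow> 'n \<Rightarrow> real) \<Rightarrow> nat^'n::_" where
  "mu S r y \<beta> = argmax_first S r (\<lambda>s. pairing \<beta> (real_vec s) y)"

definition positive_definite :: "real^'n^'n::finite \<Rightarrow> bool" where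
  "positive_definite B \<longleftrightarrow> (\<forall>v. v \<noteq> 0 \<longrightarrow> v \<bullet> (B *v v) > 0)"

definition expert_array :: "real \<Rightarrow> real^'n^'n::finite \<Rightarrow> 'n \<Rightarrow> 'n \<Rightarrow> real" where
  "expert_array c B i j = (if i = j then c * B $ i $ i else - c * B $ i $ j)"

definition normalized_weights ::
  "('n::{finite,linorder} \<Rightarrow> 'n \<Rightarrow> real) \<Rightarrow> 'n \<Rightarrow> 'n \<Rightarrow> real" where
  "normalized_weights w i j = w i j / (\<Sum>(k, l)\<in>upairs. w k l)"

definition discrepancy :: "(nat^'n::{finite,linorder}) set \<Rightarrow> ((nat^'n::_) \<times> (nat^'n::_)) set \<Rightarrow> real^'n::_ \<Rightarrow> nat^'n::_
    \<Rightarrow> ('n \<Rightarrow> 'n \<Rightarrow> real) \<Rightarrow> real^'n::_" where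
  "discrepancy S r y s w = real_vec (mu S r y (normalized_weights w)) - real_vec s"

definition mw_cost :: "real^'n \<Rightarrow> real^'n \<Rightarrow> 'n::finite \<Rightarrow> 'n \<Rightarrow> real" where
  "mw_cost \<delta> y i j =
     (if \<delta> = 0 then 0 else sgn_pair i j * qform i j ((1 / infnorm \<delta>) *\<^sub>R \<delta>) y)"

text \<open>
  For \<open>t \<ge> 1\<close>, \<open>mw_weights \<eta> S r y s t\<close> is the weight array \<open>w\<^sub>t\<close> computed from the observations
  \<open>(y 1, s 1), \<dots>, (y (t - 1), s (t - 1))\<close>; in particular \<open>w\<^sub>1 = 1\<close>.  The value at \<open>0\<close> is irrelevant.
\<close>

primrec mw_weights :: "real \<Rightarrow> (nat^'n::{finite,linorder}) set \<Rightarrow> ((nat^'n::_) \<times> (nat^'n::_)) set \<Rightarrow> (nat \<Rightarrow> real^'n::_)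
    \<Rightarrow> (nat \<Rightarrow> nat^'n::_) \<Rightarrow> nat \<Rightarrow> 'n \<Rightarrow> 'n \<Rightarrow> real" where
  "mw_weights \<eta> S r y s 0 = (\<lambda>i j. 1)"
| "mw_weights \<eta> S r y s (Suc t) =
     (if t = 0 then (\<lambda>i j. 1)
      else let w = mw_weights \<eta> S r y s t; \<delta> = discrepancy S r (y t) (s t) w
           in (\<lambda>i j. w i j * (1 - \<eta> * mw_cost \<delta> (y t) i j)))"

definition mw_loss :: "real \<Rightarrow> (nat^'n::{finite,linorder}) set \<Rightarrow> ((nat^'n::_) \<times> (nat^'n::_)) set
    \<Rightarrow> ('n \<Rightarrow> 'n \<Rightarrow> real) \<Rightarrow> (nat \<Rightarrow> real^'n::_) \<Rightarrow> (nat \<Rightarrow> nat^'n::_) \<Rightarrow> nat \<Rightarrow> real" where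
  "mw_loss \<eta> S r b y s t =
     (let w = mw_weights \<eta> S r y s t
      in pairing (\<lambda>i j. normalized_weights w i j - b i j) (discrepancy S r (y t) (s t) w) (y t))"

end

theory Submission
  imports Defs
begin

text \<open>
  The loss of round \<open>t\<close> is \<open>\<parallel>\<delta>\<^sub>t\<parallel>\<^sub>\<infinity>\<close> times the regret \<open>\<langle>b'\<^sub>t, m\<^sub>t\<rangle> - \<langle>b, m\<^sub>t\<rangle>\<close> of multiplicative
  weights against the fixed probability vector \<open>b\<close>, where \<open>b'\<^sub>t\<close> are the normalized weights.  Each of these regrets is nonnegative, because
  the algorithm's and the expert's decisions maximize the pairings with their own arrays.  Hence
  \<open>\<parallel>\<delta>\<^sub>t\<parallel>\<^sub>\<infinity>\<close> may be replaced by \<open>D\<close>, and the potential argument for multiplicative weights bounds the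
  total regret by \<open>\<eta> T + ln p / \<eta> = 2 sqrt (T ln p)\<close>.
\<close>

section \<open>Maximizers with tie-breaking by a linear order\<close>

lemma linear_order_on_finite_least:
  assumes "linear_order_on S r" "finite A" "A \<noteq> {}" "A \<subseteq> S"
  shows "\<exists>m\<in>A. \<forall>a\<in>A. (m, a) \<in> r"
  using assms(2,3,4)
proof (induction A rule: finite_ne_induct)
  case (singleton x)
  then show ?case
    using assms(1) by (auto simp: linear_order_on_def partial_order_on_def preorder_on_def refl_on_def)
next
  case (insert x F)
  then obtain m where m: "m \<in> F" "\<forall>a\<in>F. (m, a) \<in> r"
    by auto
  have tr: "trans r" and refl: "\<And>y. y \<in> S \<Longrightarrow> (y, y) \<in> r" and "total_on S r"
    using assms(1)
    by (auto simp: linear_order_on_def partial_order_on_def preorder_on_def refl_on_def)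
  moreover have "x \<in> S" "m \<in> S"
    using insert.prems m(1) by auto
  ultimately have "(x, m) \<in> r \<or> (m, x) \<in> r" and xx: "(x, x) \<in> r"
    unfolding total_on_def by metis+
  then consider "(x, m) \<in> r" | "(m, x) \<in> r"
    by blast
  then show ?case
  proof cases
    case 1
    then have "\<forall>a\<in>F. (x, a) \<in> r"
      using m tr by (meson transD)
    with xx show ?thesis
      by blast
  next
    case 2
    with m show ?thesis
      by blast
  qed
qed

text \<open>\<open>argmax_first\<close> is a \<open>THE\<close>, so nothing is known of it until
  exactly one element qualifies. The \<open>r\<close>-least element of the finite nonempty set of
  maximizers does, and antisymmetry excludes a second one.\<close>

lemma argmax_first:
  assumes "finite S" "S \<noteq> {}" "linear_order_on S r"
  shows argmax_first_in: "argmax_first S r f \<in> S"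
    and argmax_first_max: "u \<in> S \<Longrightarrow> f u \<le> f (argmax_first S r f)"
proof -
  define A where "A = {s \<in> S. \<forall>s'\<in>S. f s' \<le> f s}"
  have "Max (f ` S) \<in> f ` S"
    using assms(1,2) by auto
  then obtain s where s: "s \<in> S" "f s = Max (f ` S)"
    by auto
  then have "s \<in> A"
    using assms(1) by (auto simp: A_def)
  then obtain m where m: "m \<in> A" "\<forall>a\<in>A. (m, a) \<in> r"
    using linear_order_on_finite_least[OF assms(3), of A] assms(1) by (auto simp: A_def)
  have anti: "antisym r"
    using assms(3) by (auto simp: linear_order_on_def partial_order_on_def)
  let ?P = "\<lambda>s. s \<in> S \<and> (\<forall>s'\<in>S. f s' \<le> f s) \<and> (\<forall>s'\<in>S. f s' = f s \<longrightarrow> (s, s') \<in> r)"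
  have "?P m"
    using m by (auto simp: A_def)
  moreover have "s' = m" if "?P s'" for s'
    using that \<open>?P m\<close> anti by (meson antisymD order_antisym)
  ultimately have "?P (argmax_first S r f)"
    unfolding argmax_first_def by (rule theI[where P = ?P])
  then show "argmax_first S r f \<in> S" "u \<in> S \<Longrightarrow> f u \<le> f (argmax_first S r f)"
    by auto
qed

lemma sum_pairs_eq_sum_upairs:
  fixes f :: "'n::{finite,linorder} \<Rightarrow> 'n \<Rightarrow> real"
  shows "(\<Sum>i\<in>UNIV. \<Sum>j\<in>UNIV. f i j) =
    (\<Sum>(i, j)\<in>upairs. if i = j then f i i else f i j + f j i)"
proof -
  let ?U = "upairs :: ('n \<times> 'n) set"
  let ?L = "{(i, j). j < i} :: ('n \<times> 'n) set"
  have "(\<Sum>i\<in>UNIV. \<Sum>j\<in>UNIV. f i j) = (\<Sum>(i, j)\<in>?U \<union> ?L. f i j)"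
    unfolding sum.cartesian_product by (rule sum.cong) (auto simp: upairs_def)
  also have "\<dots> = (\<Sum>(i, j)\<in>?U. f i j) + (\<Sum>(i, j)\<in>?L. f i j)"
    by (rule sum.union_disjoint) (auto simp: upairs_def)
  also have "(\<Sum>(i, j)\<in>?L. f i j) = (\<Sum>(i, j)\<in>{(i, j). i < j}. f j i)"
    by (rule sum.reindex_bij_witness[where i = prod.swap and j = prod.swap]) auto
  also have "\<dots> = (\<Sum>(i, j)\<in>?U. if i = j then 0 else f j i)"
    by (rule sum.mono_neutral_cong_left) (auto simp: upairs_def order_less_le)
  also have "(\<Sum>(i, j)\<in>?U. f i j) + \<dots> =
      (\<Sum>(i, j)\<in>?U. if i = j then f i i else f i j + f j i)"
    unfolding sum.distrib[symmetric] by (rule sum.cong) auto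
  finally show ?thesis .
qed

text \<open>Folding the constant 1 on the full square gives weight 1 on the diagonal and 2 off it,
  so n^2 = 2 * card - n.\<close>

lemma card_upairs:
  "card (upairs :: ('n::{finite,linorder} \<times> 'n) set) = CARD('n) * (CARD('n) + 1) div 2"
proof -
  let ?U = "upairs :: ('n \<times> 'n) set"
  have "real (CARD('n) * CARD('n)) = (\<Sum>(i, j)\<in>?U. if i = j then 1 else 2)"
    using sum_pairs_eq_sum_upairs[of "\<lambda>(i::'n) (j::'n). 1"]
    by (simp only: one_add_one) simp
  also have "\<dots> = (\<Sum>k\<in>?U. 2 - (if fst k = snd k then 1 else 0))"
    by (rule sum.cong) auto
  also have "\<dots> = 2 * real (card ?U) - (\<Sum>k\<in>?U. if fst k = snd k then 1 else 0)"
    by (simp add: sum_subtractf)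
  also have "(\<Sum>k\<in>?U. if fst k = snd k then 1 else 0) = (\<Sum>k\<in>range (\<lambda>i::'n. (i, i)). 1 :: real)"
    by (rule sum.mono_neutral_cong_right) (auto simp: upairs_def)
  also have "\<dots> = real CARD('n)"
    by (simp add: card_image inj_on_def)
  finally have "real (CARD('n) * CARD('n) + CARD('n)) = real (2 * card ?U)"
    by simp
  then have "CARD('n) * CARD('n) + CARD('n) = 2 * card ?U"
    by (rule of_nat_eq_iff[THEN iffD1])
  then show ?thesis
    by (simp add: algebra_simps)
qed

text \<open>The minus sign in \<open>expert_array\<close> cancels the one in
  \<open>sgn_pair\<close>, and by symmetry \<open>qform\<close> collects the two mirrored terms of
  the bilinear form. This makes the expert's choice, defined through \<open>B\<close>, a maximizer
  of the pairing with \<open>b\<close>.\<close>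

lemma pairing_expert_array:
  assumes "transpose B = B"
  shows "pairing (expert_array c B) u v = c * (u \<bullet> (B *v v))"
proof -
  have sym: "B $ j $ i = B $ i $ j" for i j
    using assms by (metis transpose_def vec_lambda_beta)
  have "u \<bullet> (B *v v) = (\<Sum>i\<in>UNIV. \<Sum>j\<in>UNIV. B $ i $ j * u $ i * v $ j)"
    by (simp add: inner_vec_def matrix_vector_mult_def sum_distrib_left mult_ac)
  then show ?thesis
    by (auto simp: sum_pairs_eq_sum_upairs pairing_def sum_distrib_left sgn_pair_def qform_def
        expert_array_def sym algebra_simps intro!: sum.cong)
qed

lemma qform_diff_left: "qform i j (u - v) y = qform i j u y - qform i j v y"
  by (simp add: qform_def algebra_simps)

lemma qform_scaleR_left: "qform i j (k *\<^sub>R u) y = k * qform i j u y"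
  by (simp add: qform_def algebra_simps)

lemma pairing_diff_array: "pairing (\<lambda>i j. \<beta> i j - \<gamma> i j) u y = pairing \<beta> u y - pairing \<gamma> u y"
  by (simp add: pairing_def sum_subtractf[symmetric] algebra_simps split_def)

lemma pairing_diff_left: "pairing \<beta> (u - v) y = pairing \<beta> u y - pairing \<beta> v y"
  by (simp add: pairing_def sum_subtractf[symmetric] qform_diff_left algebra_simps split_def)

lemma pairing_scaleR_left: "pairing \<beta> (k *\<^sub>R u) y = k * pairing \<beta> u y"
  by (simp add: pairing_def sum_distrib_left qform_scaleR_left algebra_simps split_def)

lemma pairing_scaleR_right: "pairing \<beta> u (k *\<^sub>R y) = k * pairing \<beta> u y"
  by (auto simp: pairing_def sum_distrib_left qform_def algebra_simps intro!: sum.cong)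

text \<open>Linearity in \<delta> pulls out the factor by which \<open>mw_cost\<close> normalizes;
  for \<delta> = 0 both sides vanish. This links the loss to the costs seen by multiplicative
  weights.\<close>

lemma pairing_eq_infnorm_times_cost:
  "pairing \<beta> \<delta> y = infnorm \<delta> * (\<Sum>(i, j)\<in>upairs. \<beta> i j * mw_cost \<delta> y i j)"
proof (cases "\<delta> = 0")
  case True
  then show ?thesis
    using pairing_scaleR_left[of \<beta> 0 0 y] by (simp add: infnorm_0)
next
  case False
  then have "infnorm \<delta> \<noteq> 0"
    by (simp add: infnorm_eq_0)
  with False show ?thesis
    by (auto simp: pairing_def mw_cost_def qform_scaleR_left sum_distrib_left intro!: sum.cong)
qed

section \<open>Costs lie in [-1, 1]\<close>

lemma infnorm_component_le: "\<bar>v $ i\<bar> \<le> infnorm v" for v :: "real^'n"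
  unfolding infnorm_cart by (rule cSup_upper) (auto intro!: bdd_above_finite simp: setcompr_eq_image full_SetCompr_eq)

text \<open>The entries of the normalized discrepancy are at most 1 in absolute value, so the cost
  at (i, j) is at most y_i + y_j, or y_i on the diagonal, and hence at most the sum of
  \<open>y\<close>.\<close>

lemma abs_mw_cost_le_1:
  assumes "\<And>i. 0 \<le> y $ i" "(\<Sum>i\<in>UNIV. y $ i) \<le> 1"
  shows "\<bar>mw_cost \<delta> y i j\<bar> \<le> 1"
proof (cases "\<delta> = 0")
  case False
  define z where "z = (1 / infnorm \<delta>) *\<^sub>R \<delta>"
  have "infnorm \<delta> > 0"
    using False by (simp add: infnorm_pos_lt)
  then have z: "\<bar>z $ i\<bar> \<le> 1" for i
    using infnorm_component_le[of \<delta> i] by (simp add: z_def abs_mult)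
  have zy: "\<bar>z $ i * y $ j\<bar> \<le> y $ j" for i j
    using mult_right_mono[OF z[of i] assms(1)[of j]] assms(1)[of j] by (simp add: abs_mult)
  have "\<bar>qform i j z y\<bar> \<le> 1"
  proof (cases "i = j")
    case True
    have "y $ i \<le> (\<Sum>i\<in>UNIV. y $ i)"
      by (rule member_le_sum) (use assms(1) in auto)
    with True show ?thesis
      using zy[of i i] assms(2) by (simp add: qform_def)
  next
    case False
    have "(\<Sum>i\<in>{i, j}. y $ i) \<le> (\<Sum>i\<in>UNIV. y $ i)"
      by (rule sum_mono2) (use assms(1) in auto)
    with False show ?thesis
      using zy[of i j] zy[of j i] assms(2) by (simp add: qform_def)
  qed
  moreover have "\<bar>mw_cost \<delta> y i j\<bar> = \<bar>qform i j z y\<bar>"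
    using False by (simp add: mw_cost_def sgn_pair_def z_def abs_mult)
  ultimately show ?thesis
    by simp
qed (simp add: mw_cost_def)

lemma normalized_backlog_nonneg: "0 \<le> normalized_backlog x $ i"
  by (simp add: normalized_backlog_def real_vec_def l1_norm_def sum_nonneg)

text \<open>Equality fails for an empty backlog, whose normalization is 0.\<close>

lemma sum_normalized_backlog_le_1: "(\<Sum>i\<in>UNIV. normalized_backlog x $ i) \<le> 1"
  by (simp add: normalized_backlog_def real_vec_def l1_norm_def sum_divide_distrib[symmetric])

section \<open>The potential argument for multiplicative weights\<close>

lemma ln_one_minus_lower_bound:
  fixes x :: real
  assumes "\<bar>x\<bar> \<le> 1 / 2"
  shows "- x - x\<^sup>2 \<le> ln (1 - x)"
proof (cases "0 \<le> x")
  case True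
  \<comment> \<open>The claim amounts to 1 \<le> (1 - x) * exp u. With exp u replaced by its
    quadratic Taylor polynomial, the difference is a polynomial in x, written below as a sum of
    terms nonnegative on [0, 1/2].\<close>
  define u where "u = x + x\<^sup>2"
  have x: "0 \<le> x" "x \<le> 1 / 2"
    using assms True by auto
  have "0 \<le> x\<^sup>2 / 2 * ((1 - 2 * x) * (1 + x)) + (1 - x) * x ^ 4 / 2"
    using x by (intro add_nonneg_nonneg mult_nonneg_nonneg divide_nonneg_nonneg) auto
  also have "\<dots> = (1 - x) * (1 + u + u\<^sup>2 / 2) - 1"
    by (simp add: u_def power2_eq_square power4_eq_xxxx field_simps)
  also have "\<dots> \<le> (1 - x) * exp u - 1"
    using x exp_lower_Taylor_quadratic[of u]
    by (intro diff_right_mono mult_left_mono) (auto simp: u_def)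
  finally have "exp (- u) \<le> 1 - x"
    by (simp add: exp_minus field_simps)
  then show ?thesis
    using x by (simp add: ln_ge_iff u_def)
next
  case False
  then show ?thesis
    using assms ln_one_plus_pos_lower_bound[of "- x"] by simp
qed

lemma multiplicative_weights_pos:
  fixes w m :: "nat \<Rightarrow> 'a \<Rightarrow> real"
  assumes w1: "w 1 k = 1"
    and step: "\<And>t. t \<ge> 1 \<Longrightarrow> w (Suc t) k = w t k * (1 - \<eta> * m t k)"
    and m: "\<And>t. \<bar>m t k\<bar> \<le> 1" and \<eta>: "0 \<le> \<eta>" "\<eta> < 1" and "t \<ge> 1"
  shows "0 < w t k"
  using \<open>t \<ge> 1\<close>
proof (induction t rule: dec_induct)
  case (step t)
  have "\<eta> * m t k \<le> \<eta> * 1"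
    using m[of t] \<eta>(1) by (intro mult_left_mono) auto
  then show ?case
    using step assms(2)[of t] \<eta>(2) by simp
qed (simp add: w1[unfolded One_nat_def])

text \<open>The potential is the total weight. It is bounded above through the algorithm's average
  costs \<open>q\<close> and below by each single weight; comparing logarithms, averaging with
  \<open>b\<close> and dividing by \<eta> gives the bound.\<close>

lemma multiplicative_weights_regret:
  fixes w m :: "nat \<Rightarrow> 'a \<Rightarrow> real"
  assumes A: "finite A" "A \<noteq> {}"
    and w1: "\<And>k. k \<in> A \<Longrightarrow> w 1 k = 1"
    and step: "\<And>t k. t \<ge> 1 \<Longrightarrow> k \<in> A \<Longrightarrow> w (Suc t) k = w t k * (1 - \<eta> * m t k)"
    and m: "\<And>t k. k \<in> A \<Longrightarrow> \<bar>m t k\<bar> \<le> 1" and \<eta>: "0 < \<eta>" "\<eta> \<le> 1 / 2"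
    and b: "\<And>k. k \<in> A \<Longrightarrow> 0 \<le> b k" "sum b A = 1"
  shows "(\<Sum>t = 1..T. \<Sum>k\<in>A. (w t k / sum (w t) A - b k) * m t k)
    \<le> \<eta> * real T + ln (real (card A)) / \<eta>"
proof -
  define q where "q t = (\<Sum>k\<in>A. w t k / sum (w t) A * m t k)" for t
  have wpos: "0 < w t k" if "t \<ge> 1" "k \<in> A" for t k
    using that multiplicative_weights_pos[of w k \<eta> m t] w1 step m \<eta> by simp
  have Wpos: "0 < sum (w t) A" if "t \<ge> 1" for t
    using that wpos A by (intro sum_pos) auto
  \<comment> \<open>One round multiplies the total weight by exactly 1 - \<eta> *
    \<open>q t\<close>, which is at most exp (- \<eta> * \<open>q t\<close>); the initial total is
    \<open>card A\<close>.\<close>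
  have upper: "sum (w (Suc T)) A \<le> real (card A) * exp (- \<eta> * (\<Sum>t = 1..T. q t))" for T
  proof (induction T)
    case 0
    then show ?case
      using w1 by simp
  next
    case (Suc T)
    let ?W = "sum (w (Suc T)) A"
    have "sum (w (Suc (Suc T))) A = (\<Sum>k\<in>A. w (Suc T) k - \<eta> * (w (Suc T) k * m (Suc T) k))"
      using step by (intro sum.cong) (auto simp: algebra_simps)
    also have "\<dots> = ?W - \<eta> * (\<Sum>k\<in>A. w (Suc T) k * m (Suc T) k)"
      by (simp add: sum_subtractf sum_distrib_left)
    also have "(\<Sum>k\<in>A. w (Suc T) k * m (Suc T) k) = ?W * q (Suc T)"
      using Wpos[of "Suc T"] by (simp add: q_def sum_divide_distrib[symmetric])
    also have "?W - \<eta> * (?W * q (Suc T)) = ?W * (1 - \<eta> * q (Suc T))"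
      by (simp add: algebra_simps)
    also have "\<dots> \<le> ?W * exp (- \<eta> * q (Suc T))"
      using Wpos[of "Suc T"] exp_ge_add_one_self[of "- \<eta> * q (Suc T)"] by (intro mult_left_mono) auto
    also have "\<dots> \<le> real (card A) * exp (- \<eta> * (\<Sum>t = 1..T. q t)) * exp (- \<eta> * q (Suc T))"
      using Suc by (intro mult_right_mono) auto
    also have "\<dots> = real (card A) * exp (- \<eta> * (\<Sum>t = 1..Suc T. q t))"
      by (simp add: exp_add[symmetric] algebra_simps)
    finally show ?case .
  qed
  \<comment> \<open>Each factor costs a second-order error of at most \<eta>^2 in the logarithm;
    this is where \<eta> \<le> 1/2 enters.\<close>
  have lower: "- \<eta> * (\<Sum>t = 1..T. m t k) - \<eta>\<^sup>2 * real T \<le> ln (w (Suc T) k)" if k: "k \<in> A" for T k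
  proof (induction T)
    case 0
    then show ?case
      using w1 k by simp
  next
    case (Suc T)
    define e where "e = \<eta> * m (Suc T) k"
    have e: "\<bar>e\<bar> \<le> \<eta>"
      using m[OF k, of "Suc T"] \<eta>(1) by (simp add: e_def abs_mult mult_left_le)
    then have "e\<^sup>2 \<le> \<eta>\<^sup>2"
      using \<eta>(1) by (simp add: abs_le_square_iff[symmetric])
    moreover have "- e - e\<^sup>2 \<le> ln (1 - e)"
      using e \<eta>(2) by (intro ln_one_minus_lower_bound) simp
    moreover have "ln (w (Suc (Suc T)) k) = ln (w (Suc T) k) + ln (1 - e)"
      using step[of "Suc T" k] k wpos[of "Suc T" k] e \<eta>(2) by (simp add: e_def ln_mult)
    ultimately show ?case
      using Suc by (simp add: e_def algebra_simps)
  qed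
  let ?M = "\<lambda>k. \<Sum>t = 1..T. m t k"
  have each: "- \<eta> * ?M k - \<eta>\<^sup>2 * real T \<le> ln (real (card A)) - \<eta> * (\<Sum>t = 1..T. q t)" if k: "k \<in> A" for k
  proof -
    have "w (Suc T) k \<le> sum (w (Suc T)) A"
      using k A wpos[of "Suc T"] by (intro member_le_sum) (auto intro: less_imp_le)
    also note upper[of T]
    finally have "ln (w (Suc T) k) \<le> ln (real (card A) * exp (- \<eta> * (\<Sum>t = 1..T. q t)))"
      using wpos[of "Suc T" k] k by (intro ln_mono) auto
    also have "\<dots> = ln (real (card A)) - \<eta> * (\<Sum>t = 1..T. q t)"
      using A by (subst ln_mult) (auto simp: card_gt_0_iff)
    finally show ?thesis
      using lower[OF k, of T] by simp
  qed
  \<comment> \<open>The bound against each single index is averaged with the probability vector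
    \<open>b\<close>.\<close>
  have "(\<Sum>k\<in>A. b k * (\<eta> * (\<Sum>t = 1..T. q t))) \<le>
      (\<Sum>k\<in>A. b k * (ln (real (card A)) + \<eta>\<^sup>2 * real T + \<eta> * ?M k))"
    using each b(1) by (intro sum_mono mult_left_mono) (auto simp: algebra_simps)
  also have "\<dots> = (\<Sum>k\<in>A. b k * (ln (real (card A)) + \<eta>\<^sup>2 * real T) + \<eta> * (b k * ?M k))"
    by (intro sum.cong) (auto simp: algebra_simps)
  also have "\<dots> = ln (real (card A)) + \<eta>\<^sup>2 * real T + \<eta> * (\<Sum>k\<in>A. b k * ?M k)"
    unfolding sum.distrib sum_distrib_right[symmetric] sum_distrib_left[symmetric] b(2) by simp
  also have "(\<Sum>k\<in>A. b k * (\<eta> * (\<Sum>t = 1..T. q t))) = \<eta> * (\<Sum>t = 1..T. q t)"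
    unfolding sum_distrib_right[symmetric] b(2) by simp
  finally have "\<eta> * (\<Sum>t = 1..T. q t) \<le>
      ln (real (card A)) + \<eta>\<^sup>2 * real T + \<eta> * (\<Sum>k\<in>A. b k * ?M k)" .
  moreover have "(\<Sum>k\<in>A. b k * ?M k) = (\<Sum>t = 1..T. \<Sum>k\<in>A. b k * m t k)"
    unfolding sum_distrib_left by (rule sum.swap)
  then have "(\<Sum>t = 1..T. \<Sum>k\<in>A. (w t k / sum (w t) A - b k) * m t k) =
      (\<Sum>t = 1..T. q t) - (\<Sum>k\<in>A. b k * ?M k)"
    by (simp add: q_def left_diff_distrib sum_subtractf)
  ultimately have "\<eta> * (\<Sum>t = 1..T. \<Sum>k\<in>A. (w t k / sum (w t) A - b k) * m t k)
      \<le> \<eta> * (\<eta> * real T + ln (real (card A)) / \<eta>)"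
    using \<eta>(1) by (simp only: right_diff_distrib) (simp add: distrib_left power2_eq_square)
  then show ?thesis
    using \<eta>(1) by (simp only: mult_le_cancel_left_pos)
qed

section \<open>The average loss of the learned scheduler\<close>

theorem theorem1:
  fixes S :: "(nat^'n::{finite,linorder}) set" and r :: "((nat^'n::_) \<times> (nat^'n::_)) set"
    and B :: "real^'n::_^'n::_" and c :: real and b :: "'n \<Rightarrow> 'n \<Rightarrow> real"
    and x d a s :: "nat \<Rightarrow> nat^'n::_" and y :: "nat \<Rightarrow> real^'n::_"
    and T p :: nat and D \<eta> :: real
  assumes S: "finite S" "S \<noteq> {}"
    and tie_breaking: "linear_order_on S r"
    and B: "transpose B = B" "positive_definite B" "\<And>i j. i \<noteq> j \<Longrightarrow> B $ i $ j \<le> 0"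
    and b: "c > 0" "b = expert_array c B" "(\<Sum>(i, j)\<in>upairs. b i j) = 1"
    and expert: "\<And>t. s t = argmax_first S r (\<lambda>u. real_vec u \<bullet> (B *v real_vec (x t)))"
    and departures: "\<And>t. d t = (\<chi> i. min (s t $ i) (x t $ i))"
    and backlogs: "\<And>t. x (Suc t) = x t - d t + a t"
    and y: "\<And>t. y t = normalized_backlog (x t)"
    and p: "p = CARD('n) * (CARD('n) + 1) div 2"
    and D: "D = Max ((\<lambda>(u, v). infnorm (real_vec u - real_vec v)) ` (S \<times> S))"
    and T: "T > 0" "real T > 4 * ln (real p)"
    and \<eta>: "\<eta> = sqrt (ln (real p) / real T)"
  shows "0 \<le> (1 / real T) * (\<Sum>t = 1..T. mw_loss \<eta> S r b y s t) \<and>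
    (1 / real T) * (\<Sum>t = 1..T. mw_loss \<eta> S r b y s t) \<le> 2 * D * sqrt (ln (real p) / real T)"
proof -
  let ?U = "upairs :: ('n \<times> 'n) set"
  define w where "w t k = (case k of (i, j) \<Rightarrow> mw_weights \<eta> S r y s t i j)" for t k
  define \<delta> where "\<delta> t = discrepancy S r (y t) (s t) (mw_weights \<eta> S r y s t)" for t
  define m where "m t k = (case k of (i, j) \<Rightarrow> mw_cost (\<delta> t) (y t) i j)" for t k
  define reg where
    "reg t = (\<Sum>k\<in>?U. (w t k / sum (w t) ?U - (case k of (i, j) \<Rightarrow> b i j)) * m t k)" for t

  have U: "finite ?U" "?U \<noteq> {}"
    by (auto simp: upairs_def)
  have cardU: "card ?U = p"
    unfolding p by (rule card_upairs)
  with U have p1: "p \<ge> 1"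
    by (metis Suc_leI One_nat_def card_gt_0_iff)
  have w1: "w 1 k = 1" for k
    by (simp add: w_def split_def)
  have step: "w (Suc t) k = w t k * (1 - \<eta> * m t k)" if "t \<ge> 1" for t k
    using that by (simp add: w_def m_def \<delta>_def Let_def split_def)
  have m: "\<bar>m t k\<bar> \<le> 1" for t k
    by (auto simp: m_def y split_def
        intro!: abs_mw_cost_le_1 normalized_backlog_nonneg sum_normalized_backlog_le_1)
  \<comment> \<open>The hypothesis T > 4 ln p is exactly \<eta> < 1/2.\<close>
  have "ln (real p) / real T < (1 / 2)\<^sup>2"
    using T by (simp add: field_simps power2_eq_square)
  then have "\<eta> < sqrt ((1 / 2)\<^sup>2)"
    unfolding \<eta> by (rule real_sqrt_less_mono)
  then have \<eta>_less: "\<eta> < 1 / 2"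
    by (simp only: real_sqrt_abs)
  have \<eta>_nonneg: "0 \<le> \<eta>"
    using p1 by (simp add: \<eta>)

  \<comment> \<open>Testing positive definiteness on unit vectors gives the diagonal signs; with the
    off-diagonal hypothesis, \<open>b\<close> becomes a probability array.\<close>
  have "B $ i $ i > 0" for i
    using B(2)[unfolded positive_definite_def, rule_format, of "axis i 1"]
    by (simp add: inner_axis' matrix_vector_mul_component)
       (simp add: inner_axis)
  then have b_nonneg: "0 \<le> b i j" for i j
    using B(3)[of i j] b(1,2)
    by (auto simp: expert_array_def less_imp_le mult_nonneg_nonpos)
  have b_sum: "(\<Sum>k\<in>?U. case k of (i, j) \<Rightarrow> b i j) = 1"
    using b(3) .

  have s_in: "s t \<in> S" for t
    unfolding expert by (rule argmax_first_in[OF S tie_breaking])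
  have s_max: "pairing b (real_vec u) (y t) \<le> pairing b (real_vec (s t)) (y t)" if "u \<in> S" for u t
  proof -
    \<comment> \<open>The expert maximizes at \<open>x t\<close>, and a nonnegative rescaling to
      \<open>y t\<close> preserves this; k = 0 covers the empty backlog.\<close>
    obtain k where k: "k \<ge> 0" "y t = k *\<^sub>R real_vec (x t)"
    proof
      show "(if l1_norm (real_vec (x t)) \<noteq> 0 then 1 / l1_norm (real_vec (x t)) else 0) \<ge> 0"
        by (simp add: l1_norm_def sum_nonneg)
    qed (simp add: y normalized_backlog_def)
    have "real_vec u \<bullet> (B *v real_vec (x t)) \<le> real_vec (s t) \<bullet> (B *v real_vec (x t))"
      unfolding expert[of t] by (rule argmax_first_max[OF S tie_breaking that])
    then show ?thesis
      using k(1) b(1)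
      by (simp add: k(2) b(2) pairing_scaleR_right pairing_expert_array[OF B(1)] mult_left_mono)
  qed

  have loss_eq: "mw_loss \<eta> S r b y s t = infnorm (\<delta> t) * reg t" for t
    unfolding mw_loss_def Let_def \<delta>_def[symmetric] pairing_eq_infnorm_times_cost reg_def
    by (simp add: normalized_weights_def w_def m_def split_def)
  \<comment> \<open>The loss splits into the learner's advantage over \<open>s t\<close> under its
    own array plus the expert's advantage over the learner under \<open>b\<close>.\<close>
  have loss_nonneg: "0 \<le> mw_loss \<eta> S r b y s t" for t
  proof -
    let ?\<beta> = "normalized_weights (mw_weights \<eta> S r y s t)"
    let ?u = "mu S r (y t) ?\<beta>"
    have u: "?u \<in> S"
      unfolding mu_def by (rule argmax_first_in[OF S tie_breaking])
    have "pairing ?\<beta> (real_vec (s t)) (y t) \<le> pairing ?\<beta> (real_vec ?u) (y t)"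
      unfolding mu_def by (rule argmax_first_max[OF S tie_breaking s_in])
    with s_max[OF u, of t] show ?thesis
      by (simp add: mw_loss_def Let_def discrepancy_def pairing_diff_array pairing_diff_left)
  qed
  have infnorm_le: "infnorm (\<delta> t) \<le> D" for t
  proof -
    have "mu S r (y t) \<beta> \<in> S" for \<beta>
      unfolding mu_def by (rule argmax_first_in[OF S tie_breaking])
    then show ?thesis
      unfolding D \<delta>_def discrepancy_def using S(1) s_in by (intro Max_ge) auto
  qed
  have D_nonneg: "0 \<le> D"
    using infnorm_le[of 0] infnorm_pos_le[of "\<delta> 0"] by simp
  \<comment> \<open>Enlarging the factor to \<open>D\<close> needs \<open>reg t\<close> \<ge> 0. For
    \<delta> \<noteq> 0 this follows by dividing the nonnegative loss by the norm; for \<delta> = 0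
    all costs vanish, and so does \<open>reg t\<close>.\<close>
  have loss_le: "mw_loss \<eta> S r b y s t \<le> D * reg t" for t
  proof (cases "\<delta> t = 0")
    case True
    then show ?thesis
      unfolding loss_eq by (simp add: reg_def m_def mw_cost_def infnorm_0 split_def)
  next
    case False
    then have "0 \<le> reg t"
      using loss_nonneg[of t] infnorm_pos_lt[of "\<delta> t"] by (simp add: loss_eq zero_le_mult_iff)
    then show ?thesis
      unfolding loss_eq using infnorm_le[of t] by (intro mult_right_mono)
  qed

  have reg: "(\<Sum>t = 1..T. reg t) \<le> 2 * (real T * \<eta>)"
  proof (cases "p = 1")
    case True
    \<comment> \<open>Here \<open>\<eta> = 0\<close>, but both arrays are the only probability vector on one point.\<close>
    then obtain k where k: "?U = {k}"
      using cardU card_1_singletonE by metis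
    have "reg t = 0" if "t \<ge> 1" for t
      using multiplicative_weights_pos[of w k \<eta> m t] that w1 step m \<eta>_nonneg \<eta>_less b_sum
      by (simp add: reg_def k)
    then show ?thesis
      using \<eta>_nonneg by simp
  next
    case False
    then have \<eta>_pos: "\<eta> > 0"
      using p1 T(1) by (simp add: \<eta>)
    \<comment> \<open>The choice of \<eta> balances the two terms of the regret bound.\<close>
    have "real T * \<eta>\<^sup>2 = ln (real p)"
      using p1 T(1) by (simp add: \<eta>)
    then have "ln (real p) / \<eta> = real T * \<eta>"
      using \<eta>_pos by (simp add: field_simps power2_eq_square)
    moreover have "(\<Sum>t = 1..T. reg t) \<le> \<eta> * real T + ln (real (card ?U)) / \<eta>"
      unfolding reg_def using w1 step m \<eta>_pos \<eta>_less b_nonneg b_sum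
      by (intro multiplicative_weights_regret[OF U]) auto
    ultimately show ?thesis
      by (simp add: cardU mult.commute)
  qed

  have "(\<Sum>t = 1..T. mw_loss \<eta> S r b y s t) \<le> D * (\<Sum>t = 1..T. reg t)"
    unfolding sum_distrib_left by (intro sum_mono loss_le)
  also have "\<dots> \<le> D * (2 * (real T * \<eta>))"
    using reg D_nonneg by (intro mult_left_mono)
  finally have "(1 / real T) * (\<Sum>t = 1..T. mw_loss \<eta> S r b y s t) \<le> 2 * D * \<eta>"
    using T(1) by (simp add: field_simps)
  moreover have "0 \<le> (1 / real T) * (\<Sum>t = 1..T. mw_loss \<eta> S r b y s t)"
    using loss_nonneg by (simp add: sum_nonneg)
  ultimately show ?thesis
    unfolding \<eta> by blast
qed

end
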